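(* There are universal constants $c_1,c_2>0$ such that the following holds. Let $\mathcal{G}_0,\mathcal{G}_1,\mathcal{R},\epsilon>0$ satisfy $$\epsilon\le\frac{\mathcal{G}_0}{\mathcal{G}_1}\exp\big(\tfrac1{64}\mathcal{R}\mathcal{G}_1\big),\qquad\mathcal{R}\mathcal{G}_1\ge32,$$ and let $\eta>0$ be an arbitrary parameter. Then there exist a convex function $f\colon\mathbb{R}^d\to\mathbb{R}$ having a global minimizer $x^*$ with $\|x^*\|\le\mathcal{R}$ (put $f^*=f(x^* )$), and a corresponding stochastic gradient oracle $\nabla_\xi f\colon\mathbb{R}^d\to\mathbb{R}^d$ satisfying the $(\mathcal{G}_0,\mathcal{G}_1)$ stochastic generalized Lipschitz condition (see context), such that for the iterates $x_0=0$, $$x_{k+1}=\mathrm{proj}_{Q_{\mathcal{R}}}\big(x_k-\eta_k\nabla_{\xi_k}f(x_k)\big),\qquad\eta_k=\frac{\eta}{\sqrt{\sum_{i=0}^k\|\nabla_{\xi_i}f(x_i)\|^2}},$$ with independent $\xi_k\sim\mathcal{D}$, and $\overline{x}_K=\frac{1}{K+1}\sum_{k=0}^Kx_k$, every $K$ with $$\mathbb{E}\big[\min\{f(x_K),f(\overline{x}_K)\}-f^*\big]\le\epsilon$$ satisfies $$K\ge c_1\exp(c_2\mathcal{R}\mathcal{G}_1).$$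
   Context: $\|\cdot\|$ is the Euclidean norm; $Q_{\mathcal{R}}=\{x\in\mathbb{R}^d:\|x\|\le\mathcal{R}\}$; $\mathrm{proj}_{Q_{\mathcal R}}$ is the Euclidean projection onto $Q_{\mathcal R}$; $\nabla f(x)\in\partial f(x)$ denotes a subgradient of $f$ at $x$. $(\mathcal{G}_0,\mathcal{G}_1)$ stochastic generalized Lipschitz condition: the estimator $\nabla_\xi f(x)$, $\xi\sim\mathcal{D}$, satisfies $\mathbb{E}_{\xi\sim\mathcal{D}}[\nabla_\xi f(x)]=\nabla f(x)$ for all $x$, and admits a decomposition $\nabla_\xi f(x)=u_\xi(x)+v_\xi(x)$ such that for all $x$: $\mathbb{E}_{\xi\sim\mathcal{D}}\|u_\xi(x)\|^2\le\mathcal{G}_0^2$ and $\|v_\xi(x)\|\le\mathcal{G}_1[f(x)-f^*]$ almost surely. *)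

theory Defs
  imports "HOL-Probability.Probability" "HOL-Library.Function_Algebras"
begin

text \<open>
  The constants \<open>c\<^sub>1, c\<^sub>2\<close> of the lower bound are universal, so the dimension \<open>d\<close> has to be
  quantified inside the formula and cannot be a type. Following \<^const>\<open>Euclidean_space\<close>,
  \<open>\<real>\<^sup>d\<close> is rendered as the set of sequences vanishing from index \<open>d\<close> on, with pointwise operations.
  Functions on \<open>\<real>\<^sup>d\<close> are HOL functions of which only the values on this set matter.
\<close>

instantiation "fun" :: (type, real_vector) real_vector
begin

definition scaleR_fun :: "real \<Rightarrow> ('a \<Rightarrow> 'b) \<Rightarrow> 'a \<Rightarrow> 'b"
  where "scaleR_fun c x = (\<lambda>i. c *\<^sub>R x i)"

instance
  by standard
    (simp_all add: scaleR_fun_def plus_fun_def fun_eq_iff scaleR_add_right scaleR_add_left)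

end

definition Rd :: "nat \<Rightarrow> (nat \<Rightarrow> real) set"
  where "Rd d = {x. \<forall>i\<ge>d. x i = 0}"

lemma Rd_eq_topspace: "Rd d = topspace (Euclidean_space d)"
  by (simp add: Rd_def topspace_Euclidean_space)

text \<open>The topology on \<^typ>\<open>nat \<Rightarrow> real\<close> is the product topology, which induces the usual
  one on \<open>\<real>\<^sup>d\<close>; hence this is the usual Borel space.\<close>

definition borel_Rd :: "nat \<Rightarrow> (nat \<Rightarrow> real) measure"
  where "borel_Rd d = restrict_space borel (Rd d)"

definition norm_Rd :: "nat \<Rightarrow> (nat \<Rightarrow> real) \<Rightarrow> real"
  where "norm_Rd d x = L2_set x {..<d}"

definition inner_Rd :: "nat \<Rightarrow> (nat \<Rightarrow> real) \<Rightarrow> (nat \<Rightarrow> real) \<Rightarrow> real"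
  where "inner_Rd d x y = (\<Sum>i<d. x i * y i)"

definition subdifferential :: "nat \<Rightarrow> ((nat \<Rightarrow> real) \<Rightarrow> real) \<Rightarrow> (nat \<Rightarrow> real) \<Rightarrow> (nat \<Rightarrow> real) set"
  where "subdifferential d f x = {g \<in> Rd d. \<forall>y\<in>Rd d. f y \<ge> f x + inner_Rd d g (y - x)}"

definition Q :: "nat \<Rightarrow> real \<Rightarrow> (nat \<Rightarrow> real) set"
  where "Q d R = {x \<in> Rd d. norm_Rd d x \<le> R}"

definition proj :: "nat \<Rightarrow> (nat \<Rightarrow> real) set \<Rightarrow> (nat \<Rightarrow> real) \<Rightarrow> (nat \<Rightarrow> real)"
  where "proj d S y = arg_min_on (\<lambda>x. norm_Rd d (y - x)) S"

text \<open>
  In the following, \<open>D\<close> is the distribution of the random seed \<open>\<xi>\<close>, \<open>g \<xi> x\<close> is the estimator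
  and \<open>gradf x\<close> the chosen subgradient of \<open>f\<close> at \<open>x\<close>. Joint measurability of the estimator makes
  the iterates of a stochastic method random variables. Expectations of nonnegative quantities are
  taken as \<^const>\<open>nn_integral\<close>, since the Bochner integral of a nonintegrable function is \<open>0\<close>.
\<close>

definition unbiased_oracle ::
  "nat \<Rightarrow> ((nat \<Rightarrow> real) \<Rightarrow> real) \<Rightarrow> ((nat \<Rightarrow> real) \<Rightarrow> (nat \<Rightarrow> real)) \<Rightarrow>
   'w measure \<Rightarrow> ('w \<Rightarrow> (nat \<Rightarrow> real) \<Rightarrow> (nat \<Rightarrow> real)) \<Rightarrow> bool"
  where "unbiased_oracle d f gradf D g \<longleftrightarrow>
    (\<lambda>(\<xi>, x). g \<xi> x) \<in> D \<Otimes>\<^sub>M borel_Rd d \<rightarrow>\<^sub>M borel_Rd d \<and>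
    (\<forall>x\<in>Rd d. gradf x \<in> subdifferential d f x) \<and>
    (\<forall>x\<in>Rd d. \<forall>i<d. has_bochner_integral D (\<lambda>\<xi>. g \<xi> x i) (gradf x i))"

definition stochastic_gen_Lipschitz ::
  "real \<Rightarrow> real \<Rightarrow> nat \<Rightarrow> ((nat \<Rightarrow> real) \<Rightarrow> real) \<Rightarrow> real \<Rightarrow> ((nat \<Rightarrow> real) \<Rightarrow> (nat \<Rightarrow> real)) \<Rightarrow>
   'w measure \<Rightarrow> ('w \<Rightarrow> (nat \<Rightarrow> real) \<Rightarrow> (nat \<Rightarrow> real)) \<Rightarrow> bool"
  where "stochastic_gen_Lipschitz G\<^sub>0 G\<^sub>1 d f fstar gradf D g \<longleftrightarrow>
    unbiased_oracle d f gradf D g \<and>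
    (\<exists>u v. \<forall>x\<in>Rd d.
       (\<lambda>\<xi>. u \<xi> x) \<in> D \<rightarrow>\<^sub>M borel_Rd d \<and>
       (\<lambda>\<xi>. v \<xi> x) \<in> D \<rightarrow>\<^sub>M borel_Rd d \<and>
       (\<forall>\<xi>\<in>space D. g \<xi> x = u \<xi> x + v \<xi> x) \<and>
       (\<integral>\<^sup>+\<xi>. ennreal ((norm_Rd d (u \<xi> x))\<^sup>2) \<partial>D) \<le> ennreal (G\<^sub>0\<^sup>2) \<and>
       (AE \<xi> in D. norm_Rd d (v \<xi> x) \<le> G\<^sub>1 * (f x - fstar)))"

text \<open>
  The projected adaptive method driven by the sequence of seeds \<open>\<xi>\<close>. If the denominator of the step
  size vanishes, all gradients so far are zero, so the convention \<open>a / 0 = 0\<close> is immaterial.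
\<close>

fun iterate ::
  "nat \<Rightarrow> real \<Rightarrow> real \<Rightarrow> ('w \<Rightarrow> (nat \<Rightarrow> real) \<Rightarrow> (nat \<Rightarrow> real)) \<Rightarrow> (nat \<Rightarrow> 'w) \<Rightarrow> nat \<Rightarrow> (nat \<Rightarrow> real)"
  where
    "iterate d R \<eta> g \<xi> 0 = 0"
  | "iterate d R \<eta> g \<xi> (Suc k) =
      proj d (Q d R)
        (iterate d R \<eta> g \<xi> k -
         (\<eta> / sqrt (\<Sum>i\<le>k. (norm_Rd d (g (\<xi> i) (iterate d R \<eta> g \<xi> i)))\<^sup>2)) *\<^sub>R
           g (\<xi> k) (iterate d R \<eta> g \<xi> k))"

definition average_iterate ::
  "nat \<Rightarrow> real \<Rightarrow> real \<Rightarrow> ('w \<Rightarrow> (nat \<Rightarrow> real) \<Rightarrow> (nat \<Rightarrow> real)) \<Rightarrow> (nat \<Rightarrow> 'w) \<Rightarrow> nat \<Rightarrow> (nat \<Rightarrow> real)"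
  where "average_iterate d R \<eta> g \<xi> K = (1 / real (K + 1)) *\<^sub>R (\<Sum>k\<le>K. iterate d R \<eta> g \<xi> k)"

text \<open>Independent seeds \<open>\<xi>\<^sub>k \<sim> D\<close> are the coordinates of the infinite product space.\<close>

definition expected_gap ::
  "nat \<Rightarrow> real \<Rightarrow> real \<Rightarrow> ((nat \<Rightarrow> real) \<Rightarrow> real) \<Rightarrow> real \<Rightarrow>
   'w measure \<Rightarrow> ('w \<Rightarrow> (nat \<Rightarrow> real) \<Rightarrow> (nat \<Rightarrow> real)) \<Rightarrow> nat \<Rightarrow> ennreal"
  where "expected_gap d R \<eta> f fstar D g K =
    (\<integral>\<^sup>+\<xi>. ennreal (min (f (iterate d R \<eta> g \<xi> K)) (f (average_iterate d R \<eta> g \<xi> K)) - fstar)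
       \<partial>(\<Pi>\<^sub>M k\<in>(UNIV :: nat set). D))"

end

theory Submission
  imports Defs
begin

text \<open>
  The oracle can be deterministic and the function can depend on the first coordinate only, through
  \<open>t \<mapsto> G\<^sub>0 / G\<^sub>1 * (exp (G\<^sub>1 * \<bar>t - m\<bar>) - 1)\<close>, made linear far from the minimizer \<open>m\<close>.
  The placement of \<open>m\<close> and of the two linear parts depends on \<open>\<eta>\<close>. For \<open>\<eta> \<le> R / 2\<close> the minimizer
  is \<open>R\<close>: gradients decay exponentially on the way there, while the step sizes remember the first one.
  For \<open>R / 2 \<le> \<eta> \<le> R * exp (R * G\<^sub>1 / 32)\<close> the minimizer is \<open>R / 8\<close> and the function is linear with
  a much smaller slope to its right: the first step overshoots and the way back is slow, again
  because of the first gradient. For larger \<open>\<eta>\<close>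
  all relevant slopes have equal modulus and the iterates bounce between \<open>R\<close> and \<open>- R\<close>. In all
  cases the iterates and their averages keep a distance \<open>R / 16\<close> from \<open>m\<close> for exponentially long,
  so that the gap exceeds \<open>G\<^sub>0 / G\<^sub>1 * exp (R * G\<^sub>1 / 64)\<close>.
\<close>

section \<open>Reduction to the real line along the first coordinate axis\<close>

definition e0 :: "real \<Rightarrow> nat \<Rightarrow> real"
  where "e0 t = (\<lambda>i. if i = 0 then t else 0)"

lemma e0_nth [simp]: "e0 t 0 = t" "i \<noteq> 0 \<Longrightarrow> e0 t i = 0"
  by (auto simp: e0_def)

lemma e0_diff: "e0 s - e0 t = e0 (s - t)"
  by (auto simp: e0_def fun_eq_iff)

lemma scaleR_e0: "c *\<^sub>R e0 t = e0 (c * t)"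
  by (auto simp: e0_def fun_eq_iff scaleR_fun_def)

lemma sum_fun_apply: "(\<Sum>k\<in>A. F k) i = (\<Sum>k\<in>A. F k i)" for F :: "'a \<Rightarrow> 'b \<Rightarrow> 'c::comm_monoid_add"
  by (induction A rule: infinite_finite_induct) auto

lemma sum_e0: "(\<Sum>k\<in>A. e0 (t k)) = e0 (\<Sum>k\<in>A. t k)"
  by (auto simp: e0_def fun_eq_iff sum_fun_apply)

lemma e0_in_Rd: "1 \<le> d \<Longrightarrow> e0 t \<in> Rd d"
  by (auto simp: Rd_def e0_def)

lemma norm_Rd_e0: "1 \<le> d \<Longrightarrow> norm_Rd d (e0 t) = \<bar>t\<bar>"
proof -
  assume d: "1 \<le> d"
  have "(\<Sum>i<d. (e0 t i)\<^sup>2) = (\<Sum>i<d. if i = 0 then t\<^sup>2 else 0)"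
    by (intro sum.cong) (auto simp: e0_def)
  then show ?thesis
    using d by (simp add: norm_Rd_def L2_set_def)
qed

lemma inner_Rd_e0: "1 \<le> d \<Longrightarrow> inner_Rd d (e0 t) y = t * y 0"
proof -
  assume d: "1 \<le> d"
  have "inner_Rd d (e0 t) y = (\<Sum>i<d. if i = 0 then t * y 0 else 0)"
    unfolding inner_Rd_def by (intro sum.cong) (auto simp: e0_def)
  then show ?thesis
    using d by simp
qed

lemma abs_nth_le_norm_Rd: "i < d \<Longrightarrow> \<bar>x i\<bar> \<le> norm_Rd d x"
  using member_le_L2_set[of "{..<d}" i "\<lambda>i. \<bar>x i\<bar>"] by (simp add: norm_Rd_def L2_set_def)

definition clip :: "real \<Rightarrow> real \<Rightarrow> real"
  where "clip R t = max (- R) (min R t)"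

lemma abs_diff_clip_le: "\<bar>s\<bar> \<le> R \<Longrightarrow> \<bar>t - clip R t\<bar> \<le> \<bar>t - s\<bar>"
  by (auto simp: clip_def max_def min_def)

lemma eq_clip: "\<bar>s\<bar> \<le> R \<Longrightarrow> \<bar>t - s\<bar> \<le> \<bar>t - clip R t\<bar> \<Longrightarrow> s = clip R t"
  by (auto simp: clip_def max_def min_def split: if_splits)

text \<open>\<open>proj\<close> picks a minimizer by Hilbert choice, so the proof needs a minimizer
  and also its uniqueness. The distance to \<open>e0 t\<close> is at least the difference of the
  first coordinates, which the clipped point attains exactly.\<close>

lemma proj_e0:
  assumes d: "1 \<le> d" and R: "0 \<le> R"
  shows "proj d (Q d R) (e0 t) = e0 (clip R t)"
proof -
  have nth: "\<bar>x 0\<bar> \<le> R" if "x \<in> Q d R" for x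
    using abs_nth_le_norm_Rd[of 0 d x] d that by (auto simp: Q_def)
  have coord: "\<bar>t - x 0\<bar> \<le> norm_Rd d (e0 t - x)" for x
    using abs_nth_le_norm_Rd[of 0 d "e0 t - x"] d by simp
  have dist: "norm_Rd d (e0 t - e0 (clip R t)) = \<bar>t - clip R t\<bar>"
    by (simp add: e0_diff norm_Rd_e0[OF d])
  have "is_arg_min (\<lambda>x. norm_Rd d (e0 t - x)) (\<lambda>x. x \<in> Q d R) (e0 (clip R t))"
    unfolding is_arg_min_linorder
  proof (intro conjI allI impI)
    show "e0 (clip R t) \<in> Q d R"
      using R by (auto simp: Q_def e0_in_Rd[OF d] norm_Rd_e0[OF d] clip_def)
    show "norm_Rd d (e0 t - e0 (clip R t)) \<le> norm_Rd d (e0 t - y)" if "y \<in> Q d R" for y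
      using abs_diff_clip_le[OF nth[OF that]] coord[of y] unfolding dist
      by (meson order_trans)
  qed
  moreover have "x = e0 (clip R t)"
    if x: "is_arg_min (\<lambda>x. norm_Rd d (e0 t - x)) (\<lambda>x. x \<in> Q d R) x" for x
  proof -
    have xQ: "x \<in> Q d R" and le: "norm_Rd d (e0 t - x) \<le> \<bar>t - clip R t\<bar>"
      using x calculation unfolding is_arg_min_linorder dist[symmetric] by auto
    have x0: "x 0 = clip R t"
      using eq_clip[OF nth[OF xQ]] coord[of x] le by (meson order_trans)
    have "x i = 0" if "0 < i" "i < d" for i
    proof -
      \<comment> \<open>The first coordinate alone already uses up the minimal squared distance, so
        nothing is left for coordinate \<open>i\<close>.\<close>
      have "(\<Sum>j\<in>{0,i}. ((e0 t - x) j)\<^sup>2) \<le> (\<Sum>j<d. ((e0 t - x) j)\<^sup>2)"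
        using that by (intro sum_mono2) auto
      also have "\<dots> = (norm_Rd d (e0 t - x))\<^sup>2"
        by (simp add: norm_Rd_def L2_set_def sum_nonneg)
      also have "\<dots> \<le> (t - clip R t)\<^sup>2"
        using le by (metis L2_set_nonneg abs_le_square_iff abs_of_nonneg norm_Rd_def)
      finally show ?thesis
        using that x0 by simp
    qed
    moreover have "x i = 0" if "d \<le> i" for i
      using xQ that by (auto simp: Q_def Rd_def)
    ultimately show ?thesis
      using x0 by (metis e0_def fun_eq_iff gr0I not_le_imp_less e0_nth)
  qed
  ultimately show ?thesis
    unfolding proj_def arg_min_on_def arg_min_def by (metis (mono_tags, lifting) someI)
qed

text \<open>This congruence rule lets the termination proof of the next function see that the
  recursive calls inside the norm are at indices \<open>i \<le> k\<close> only.\<close>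

declare L2_set_cong [fundef_cong]

text \<open>The slope is divided by the norm of all slopes so far before \<open>\<eta>\<close> is
  applied: the estimates below bound this ratio, whose modulus never exceeds 1.\<close>

fun line_iterate :: "real \<Rightarrow> real \<Rightarrow> (real \<Rightarrow> real) \<Rightarrow> nat \<Rightarrow> real"
  where
    "line_iterate R \<eta> h' 0 = 0"
  | "line_iterate R \<eta> h' (Suc k) =
      clip R (line_iterate R \<eta> h' k -
        \<eta> * (h' (line_iterate R \<eta> h' k) / L2_set (\<lambda>i. h' (line_iterate R \<eta> h' i)) {..k}))"

definition line_average :: "real \<Rightarrow> real \<Rightarrow> (real \<Rightarrow> real) \<Rightarrow> nat \<Rightarrow> real"
  where "line_average R \<eta> h' K = (\<Sum>k\<le>K. line_iterate R \<eta> h' k) / real (K + 1)"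

text \<open>Starting at 0 with all gradients on the first axis, the method never leaves that axis.
  Strong induction is used because the step size involves every earlier iterate.\<close>

lemma iterate_e0:
  assumes "1 \<le> d" "0 \<le> R"
  shows "iterate d R \<eta> (\<lambda>_ x. e0 (h' (x 0))) \<xi> k = e0 (line_iterate R \<eta> h' k)"
proof (induction k rule: less_induct)
  case (less k)
  show ?case
  proof (cases k)
    case 0
    then show ?thesis
      by (auto simp: e0_def fun_eq_iff)
  next
    case (Suc n)
    have IH: "iterate d R \<eta> (\<lambda>_ x. e0 (h' (x 0))) \<xi> i = e0 (line_iterate R \<eta> h' i)" if "i \<le> n" for i
      using less Suc that by auto
    have "(\<Sum>i\<le>n. (norm_Rd d (e0 (h' (iterate d R \<eta> (\<lambda>_ x. e0 (h' (x 0))) \<xi> i 0))))\<^sup>2)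
        = (\<Sum>i\<le>n. (h' (line_iterate R \<eta> h' i))\<^sup>2)"
      by (intro sum.cong) (auto simp: IH norm_Rd_e0[OF assms(1)])
    then show ?thesis
      by (simp add: Suc IH e0_diff scaleR_e0 proj_e0[OF assms] L2_set_def)
  qed
qed

lemma average_iterate_e0:
  assumes "1 \<le> d" "0 \<le> R"
  shows "average_iterate d R \<eta> (\<lambda>_ x. e0 (h' (x 0))) \<xi> K = e0 (line_average R \<eta> h' K)"
  by (simp add: average_iterate_def line_average_def iterate_e0[OF assms] sum_e0 scaleR_e0)

text \<open>The oracle ignores its seed, so the integrand is constant on a space of mass 1.\<close>

lemma expected_gap_e0:
  assumes "1 \<le> d" "0 \<le> R" "prob_space D"
  shows "expected_gap d R \<eta> (\<lambda>x. h (x 0)) c D (\<lambda>_ x. e0 (h' (x 0))) K =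
    ennreal (min (h (line_iterate R \<eta> h' K)) (h (line_average R \<eta> h' K)) - c)"
proof -
  interpret P: prob_space "\<Pi>\<^sub>M k\<in>(UNIV :: nat set). D"
    using assms(3) by (intro prob_space_PiM)
  show ?thesis
    unfolding expected_gap_def
    by (simp add: iterate_e0[OF assms(1,2)] average_iterate_e0[OF assms(1,2)] P.emeasure_space_1)
qed

section \<open>Convexity and oracle conditions from one-dimensional subgradients\<close>

text \<open>Averaging the two supporting-line inequalities at the convex combination
  \<open>z\<close> cancels the linear terms.\<close>

lemma convex_on_Rd_of_subgradient:
  assumes sub: "\<And>x y. h x + h' x * (y - x) \<le> h y"
  shows "convex_on (Rd d) (\<lambda>x. h (x 0))"
proof -
  have "convex (Rd d)"
    by (auto simp: convex_def Rd_def scaleR_fun_def)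
  moreover have "h ((u *\<^sub>R x + v *\<^sub>R y) 0) \<le> u * h (x 0) + v * h (y 0)"
    if "0 \<le> u" "0 \<le> v" "u + v = 1" for x y :: "nat \<Rightarrow> real" and u v :: real
  proof -
    define z where "z = u * x 0 + v * y 0"
    have u: "u = 1 - v"
      using that by simp
    have "u * (h z + h' z * (x 0 - z)) + v * (h z + h' z * (y 0 - z)) \<le> u * h (x 0) + v * h (y 0)"
      using that sub by (intro add_mono mult_left_mono) auto
    moreover have "u * (h z + h' z * (x 0 - z)) + v * (h z + h' z * (y 0 - z)) = h z"
      unfolding z_def u by (simp add: algebra_simps)
    ultimately show ?thesis
      by (simp add: z_def scaleR_fun_def)
  qed
  ultimately show ?thesis
    by (auto simp: convex_on_def)
qed

text \<open>A deterministic gradient of modulus at most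
  \<open>G\<^sub>0 + G\<^sub>1 * (h x - c)\<close> can be split in the proportion of these two
  summands: the share \<open>\<theta> x\<close> serves as \<open>u\<close>, the rest as
  \<open>v\<close>.\<close>

lemma stochastic_gen_Lipschitz_e0:
  assumes d: "1 \<le> d" and D: "prob_space D" and G: "0 < G\<^sub>0" "0 \<le> G\<^sub>1"
    and sub: "\<And>x y. h x + h' x * (y - x) \<le> h y"
    and growth: "\<And>x. \<bar>h' x\<bar> \<le> G\<^sub>0 + G\<^sub>1 * (h x - c)"
    and above: "\<And>x. c \<le> h x"
    and meas: "h' \<in> borel_measurable borel"
  shows "stochastic_gen_Lipschitz G\<^sub>0 G\<^sub>1 d (\<lambda>x. h (x 0)) c (\<lambda>x. e0 (h' (x 0))) D
    (\<lambda>_ x. e0 (h' (x 0)))"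
proof -
  interpret prob_space D by fact
  define \<theta> where "\<theta> x = G\<^sub>0 / (G\<^sub>0 + G\<^sub>1 * (h x - c))" for x
  have pos: "0 < G\<^sub>0 + G\<^sub>1 * (h x - c)" for x
    using G above[of x] by (intro add_pos_nonneg mult_nonneg_nonneg) auto
  have \<theta>: "0 \<le> \<theta> x" "\<theta> x \<le> 1" for x
    using G above[of x] pos[of x] by (auto simp: \<theta>_def divide_simps)
  have u: "\<bar>\<theta> x * h' x\<bar> \<le> G\<^sub>0" for x
  proof -
    have "\<bar>\<theta> x * h' x\<bar> \<le> \<theta> x * (G\<^sub>0 + G\<^sub>1 * (h x - c))"
      using \<theta>[of x] growth[of x] by (simp add: abs_mult mult_left_mono)
    also have "\<dots> = G\<^sub>0"
      using pos[of x] by (simp add: \<theta>_def)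
    finally show ?thesis .
  qed
  have v: "\<bar>(1 - \<theta> x) * h' x\<bar> \<le> G\<^sub>1 * (h x - c)" for x
  proof -
    have "\<bar>(1 - \<theta> x) * h' x\<bar> \<le> (1 - \<theta> x) * (G\<^sub>0 + G\<^sub>1 * (h x - c))"
      using \<theta>[of x] growth[of x] by (simp add: abs_mult mult_left_mono)
    also have "\<dots> = G\<^sub>1 * (h x - c)"
      using pos[of x] by (simp add: \<theta>_def field_simps)
    finally show ?thesis .
  qed
  have e0_space: "e0 t \<in> space (borel_Rd d)" for t
    by (simp add: borel_Rd_def space_restrict_space e0_in_Rd[OF d])
  have "(\<lambda>x. x 0) \<in> borel_measurable (borel_Rd d)"
    unfolding borel_Rd_def by (intro measurable_restrict_space1 measurable_product_coordinates)
  then have "(\<lambda>p. h' (snd p 0)) \<in> borel_measurable (D \<Otimes>\<^sub>M borel_Rd d)"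
    using meas by measurable
  then have "(\<lambda>p. e0 (h' (snd p 0))) \<in> borel_measurable (D \<Otimes>\<^sub>M borel_Rd d)"
    by (intro measurable_coordinatewise_then_product) (auto simp: e0_def)
  then have "(\<lambda>(\<xi>, x). e0 (h' (x 0))) \<in> D \<Otimes>\<^sub>M borel_Rd d \<rightarrow>\<^sub>M borel_Rd d"
    unfolding borel_Rd_def[of d] by (intro measurable_restrict_space2)
      (auto simp: e0_in_Rd[OF d] case_prod_beta' borel_Rd_def)
  moreover have "e0 (h' (x 0)) \<in> subdifferential d (\<lambda>x. h (x 0)) x" for x
    using sub by (auto simp: subdifferential_def e0_in_Rd[OF d] inner_Rd_e0[OF d])
  moreover have "has_bochner_integral D (\<lambda>_. t) t" for t :: real
    by (simp add: has_bochner_integral_iff prob_space)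
  ultimately have "unbiased_oracle d (\<lambda>x. h (x 0)) (\<lambda>x. e0 (h' (x 0))) D (\<lambda>_ x. e0 (h' (x 0)))"
    by (auto simp: unbiased_oracle_def)
  moreover have "\<exists>u v. \<forall>x\<in>Rd d.
       (\<lambda>\<xi>. u \<xi> x) \<in> D \<rightarrow>\<^sub>M borel_Rd d \<and>
       (\<lambda>\<xi>. v \<xi> x) \<in> D \<rightarrow>\<^sub>M borel_Rd d \<and>
       (\<forall>\<xi>\<in>space D. e0 (h' (x 0)) = u \<xi> x + v \<xi> x) \<and>
       (\<integral>\<^sup>+\<xi>. ennreal ((norm_Rd d (u \<xi> x))\<^sup>2) \<partial>D) \<le> ennreal (G\<^sub>0\<^sup>2) \<and>
       (AE \<xi> in D. norm_Rd d (v \<xi> x) \<le> G\<^sub>1 * (h (x 0) - c))"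
  proof (rule exI[of _ "\<lambda>_ x. e0 (\<theta> (x 0) * h' (x 0))"],
      rule exI[of _ "\<lambda>_ x. e0 ((1 - \<theta> (x 0)) * h' (x 0))"], rule ballI, intro conjI)
    fix x :: "nat \<Rightarrow> real"
    show "\<forall>\<xi>\<in>space D. e0 (h' (x 0)) = e0 (\<theta> (x 0) * h' (x 0)) + e0 ((1 - \<theta> (x 0)) * h' (x 0))"
      by (auto simp: e0_def fun_eq_iff algebra_simps)
    have "(\<theta> (x 0) * h' (x 0))\<^sup>2 \<le> G\<^sub>0\<^sup>2"
      using u[of "x 0"] by (rule power2_le_iff_abs_le[THEN iffD2, rotated]) (use G in auto)
    then show "(\<integral>\<^sup>+\<xi>. ennreal ((norm_Rd d (e0 (\<theta> (x 0) * h' (x 0))))\<^sup>2) \<partial>D) \<le> ennreal (G\<^sub>0\<^sup>2)"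
      by (simp add: norm_Rd_e0[OF d] emeasure_space_1 ennreal_leI)
  qed (use v e0_space in \<open>auto simp: norm_Rd_e0[OF d] borel_Rd_def\<close>)
  ultimately show ?thesis
    by (auto simp: stochastic_gen_Lipschitz_def)
qed

section \<open>The convex profile and its slopes\<close>

text \<open>\<open>exp s - 1\<close>, continued beyond \<open>A\<close> along its tangent.\<close>

definition capped_exp :: "real \<Rightarrow> real \<Rightarrow> real"
  where "capped_exp A s = exp (min s A) * (1 + s - min s A) - 1"

text \<open>The supporting line at \<open>x\<close> is the tangent of \<open>exp s - 1\<close> at
  \<open>min x A\<close>. Up to \<open>min y A\<close> it is controlled by convexity of
  \<open>exp\<close>. A remaining stretch exists only for \<open>y > A\<close>, where the slope
  \<open>exp A\<close> is at least \<open>exp (min x A)\<close>.\<close>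

lemma capped_exp_subgradient:
  "capped_exp A x + exp (min x A) * (y - x) \<le> capped_exp A y"
proof -
  define x' y' where "x' = min x A" and "y' = min y A"
  have tangent: "exp x' * (1 + (y' - x')) \<le> exp y'"
    using mult_left_mono[OF exp_ge_add_one_self[of "y' - x'"], of "exp x'"]
    by (simp add: exp_diff)
  have "exp x' * (y - y') \<le> exp y' * (y - y')"
    by (cases "y \<le> A") (auto simp: x'_def y'_def intro!: mult_right_mono)
  with tangent have "exp x' * (1 + (y' - x')) + exp x' * (y - y') \<le> exp y' + exp y' * (y - y')"
    by (rule add_mono)
  then show ?thesis
    unfolding capped_exp_def x'_def[symmetric] y'_def[symmetric] by (simp add: algebra_simps)
qed

lemma capped_exp_0 [simp]: "0 \<le> A \<Longrightarrow> capped_exp A 0 = 0"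
  by (simp add: capped_exp_def)

lemma capped_exp_le: "0 \<le> A \<Longrightarrow> capped_exp A s \<le> exp (min s A) * s"
  using capped_exp_subgradient[of A s 0] by simp

lemma capped_exp_nonneg: "0 \<le> A \<Longrightarrow> 0 \<le> s \<Longrightarrow> 0 \<le> capped_exp A s"
  using capped_exp_subgradient[of A 0 s] by simp

text \<open>This is the source of the generalized Lipschitz growth: up to \<open>A\<close> slope and
  value differ by exactly 1, beyond \<open>A\<close> only the value grows.\<close>

lemma exp_min_le_capped_exp: "exp (min s A) \<le> 1 + capped_exp A s"
  by (auto simp: capped_exp_def min_def algebra_simps)

text \<open>The two sides have separate caps \<open>A\<close> (right) and \<open>B\<close> (left) on
  the logarithm of the slope, so that one side can be made far steeper than the other.\<close>

definition valley :: "real \<Rightarrow> real \<Rightarrow> real \<Rightarrow> real"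
  where "valley A B s = (if s < 0 then capped_exp B (- s) else capped_exp A s)"

definition valley_slope :: "real \<Rightarrow> real \<Rightarrow> real \<Rightarrow> real"
  where "valley_slope A B s = (if s < 0 then - exp (min (- s) B) else exp (min s A))"

lemma valley_nonneg: "0 \<le> A \<Longrightarrow> 0 \<le> B \<Longrightarrow> 0 \<le> valley A B s"
  by (auto simp: valley_def intro!: capped_exp_nonneg)

lemma abs_valley_slope_le: "\<bar>valley_slope A B s\<bar> \<le> 1 + valley A B s"
  by (auto simp: valley_def valley_slope_def exp_min_le_capped_exp)

lemma valley_subgradient:
  assumes "0 \<le> A" "0 \<le> B"
  shows "valley A B x + valley_slope A B x * (y - x) \<le> valley A B y"
proof -
  consider "x < 0" "y < 0" | "0 \<le> x" "0 \<le> y" | "x < 0" "0 \<le> y" | "0 \<le> x" "y < 0"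
    by linarith
  then show ?thesis
  proof cases
    case 1
    then show ?thesis
      using capped_exp_subgradient[of B "-x" "-y"] by (simp add: valley_def valley_slope_def algebra_simps)
  next
    case 2
    then show ?thesis
      using capped_exp_subgradient[of A x y] by (simp add: valley_def valley_slope_def)
  next
    case 3
    \<comment> \<open>The supporting line at \<open>x\<close> lies below the parallel line through
      the origin, which is nonpositive on the other side of 0, where \<open>valley\<close> is
      nonnegative. The last case is symmetric.\<close>
    have "capped_exp B (- x) - exp (min (- x) B) * (y - x) \<le> - exp (min (- x) B) * y"
      using capped_exp_le[of B "- x"] assms by (simp add: algebra_simps)
    also have "\<dots> \<le> 0"
      using 3 by simp
    also have "0 \<le> valley A B y"
      using assms by (rule valley_nonneg)
    finally show ?thesis
      using 3 by (simp add: valley_def[of A B x] valley_slope_def)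
  next
    case 4
    have "capped_exp A x + exp (min x A) * (y - x) \<le> exp (min x A) * y"
      using capped_exp_le[of A x] assms by (simp add: algebra_simps)
    also have "\<dots> \<le> 0"
      using 4 by (simp add: mult_nonneg_nonpos)
    also have "0 \<le> valley A B y"
      using assms by (rule valley_nonneg)
    finally show ?thesis
      using 4 by (simp add: valley_def[of A B x] valley_slope_def)
  qed
qed

text \<open>The tangent at \<open>\<rho> / 32\<close> is followed over a distance of at least
  \<open>\<rho> / 32 \<ge> 1\<close>. This doubles \<open>exp (\<rho> / 32)\<close>, and the second
  copy absorbs the constant \<open>- 1\<close>.\<close>

lemma capped_exp_gt:
  assumes "32 \<le> \<rho>" "\<rho> / 32 \<le> A" "\<rho> / 16 \<le> s"
  shows "exp (\<rho> / 64) < capped_exp A s"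
proof -
  have "exp (\<rho> / 32) \<le> exp (\<rho> / 32) * (s - \<rho> / 32)"
    using assms by simp
  moreover have "min (\<rho> / 32) A = \<rho> / 32" "capped_exp A (\<rho> / 32) = exp (\<rho> / 32) - 1"
    using assms by (auto simp: capped_exp_def)
  ultimately have "2 * exp (\<rho> / 32) - 1 \<le> capped_exp A s"
    using capped_exp_subgradient[of A "\<rho> / 32" s]
    by linarith
  moreover have "1 < exp (\<rho> / 32)" "exp (\<rho> / 64) < exp (\<rho> / 32)"
    using assms by auto
  ultimately show ?thesis
    by linarith
qed

lemma valley_gt:
  assumes "32 \<le> \<rho>" "\<rho> / 32 \<le> A" "\<rho> / 32 \<le> B" "\<rho> / 16 \<le> \<bar>s\<bar>"
  shows "exp (\<rho> / 64) < valley A B s"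
  using assms capped_exp_gt[of \<rho> A s] capped_exp_gt[of \<rho> B "- s"] by (auto simp: valley_def)

lemma valley_slope_measurable: "valley_slope A B \<in> borel_measurable borel"
  unfolding valley_slope_def by measurable

text \<open>A subgradient of
  \<open>G\<^sub>0 / G\<^sub>1 * valley A B (G\<^sub>1 * (t - m))\<close>; the inner factor
  \<open>G\<^sub>1\<close> cancels the outer denominator.\<close>

definition hard_slope :: "real \<Rightarrow> real \<Rightarrow> real \<Rightarrow> real \<Rightarrow> real \<Rightarrow> real \<Rightarrow> real"
  where "hard_slope G\<^sub>0 G\<^sub>1 m A B t = G\<^sub>0 * valley_slope A B (G\<^sub>1 * (t - m))"

lemma hard_slope_le:
  assumes "0 < G\<^sub>0"
  shows "hard_slope G\<^sub>0 G\<^sub>1 m A B t \<le> G\<^sub>0 * exp A"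
proof -
  have "valley_slope A B s \<le> exp A" for s
    by (auto simp: valley_slope_def intro: order_trans[of _ 0])
  then show ?thesis
    using assms by (simp add: hard_slope_def)
qed

lemma hard_slope_left:
  assumes "0 < G\<^sub>1" "t < m"
  shows "hard_slope G\<^sub>0 G\<^sub>1 m A B t = - (G\<^sub>0 * exp (min (G\<^sub>1 * (m - t)) B))"
proof -
  have "G\<^sub>1 * (t - m) < 0"
    using assms by (simp add: mult_pos_neg)
  moreover have "- (G\<^sub>1 * (t - m)) = G\<^sub>1 * (m - t)"
    by (simp add: algebra_simps)
  ultimately show ?thesis
    by (simp only: hard_slope_def valley_slope_def if_True mult_minus_right)
qed

lemma hard_slope_right:
  assumes "0 < G\<^sub>1" "m \<le> t"
  shows "hard_slope G\<^sub>0 G\<^sub>1 m A B t = G\<^sub>0 * exp (min (G\<^sub>1 * (t - m)) A)"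
  using assms by (simp add: hard_slope_def valley_slope_def mult_less_0_iff)

section \<open>Iterates in the three ranges of the step parameter\<close>

lemma abs_le_L2_set: "i \<in> A \<Longrightarrow> finite A \<Longrightarrow> \<bar>a i\<bar> \<le> L2_set a A"
  using member_le_L2_set[of A i "\<lambda>i. \<bar>a i\<bar>"] by (simp add: L2_set_def)

lemma L2_set_abs_const:
  "(\<And>i. i \<in> A \<Longrightarrow> \<bar>a i\<bar> = c) \<Longrightarrow> 0 \<le> c \<Longrightarrow> L2_set a A = sqrt (real (card A)) * c"
proof -
  assume a: "\<And>i. i \<in> A \<Longrightarrow> \<bar>a i\<bar> = c" and c: "0 \<le> c"
  have "(\<Sum>i\<in>A. (a i)\<^sup>2) = (\<Sum>i\<in>A. c\<^sup>2)"
  proof (rule sum.cong)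
    show "(a i)\<^sup>2 = c\<^sup>2" if "i \<in> A" for i
      by (metis a[OF that] power2_abs)
  qed simp
  then show ?thesis
    using c by (simp add: L2_set_def real_sqrt_mult)
qed

lemma line_average_le:
  "(\<And>k. k \<le> K \<Longrightarrow> line_iterate R \<eta> h' k \<le> b) \<Longrightarrow> line_average R \<eta> h' K \<le> b"
proof -
  assume b: "\<And>k. k \<le> K \<Longrightarrow> line_iterate R \<eta> h' k \<le> b"
  have "(\<Sum>k\<le>K. line_iterate R \<eta> h' k) \<le> (\<Sum>k\<le>K. b)"
    using b by (intro sum_mono) auto
  then show ?thesis
    by (simp add: line_average_def field_simps)
qed

text \<open>A step from above \<open>3R/8\<close> is shorter than \<open>\<eta>\<close> by the ratio of the slopes at \<open>3R/8\<close> and at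
  the starting point \<open>0\<close>, which is exponentially small.\<close>

lemma short_step_regime:
  assumes G: "0 < G\<^sub>0" "0 < G\<^sub>1" and R: "0 < R" and \<eta>: "0 < \<eta>" "\<eta> \<le> R / 2"
  defines "z \<equiv> line_iterate R \<eta> (hard_slope G\<^sub>0 G\<^sub>1 R (R * G\<^sub>1) (R * G\<^sub>1))"
  shows "z k \<le> 7 / 8 * R + real k * (R / 2 * exp (- (3 / 8 * (R * G\<^sub>1))))"
proof (induction k)
  case 0
  then show ?case
    using R by (simp add: z_def)
next
  case (Suc k)
  define p where "p = hard_slope G\<^sub>0 G\<^sub>1 R (R * G\<^sub>1) (R * G\<^sub>1)"
  define S where "S = L2_set (\<lambda>i. p (z i)) {..k}"
  define \<delta> where "\<delta> = R / 2 * exp (- (3 / 8 * (R * G\<^sub>1)))"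
  have \<delta>: "0 < \<delta>"
    using R by (simp add: \<delta>_def)
  have p0: "p 0 = - (G\<^sub>0 * exp (R * G\<^sub>1))"
    using G R by (simp add: p_def hard_slope_left mult.commute)
  have S0: "G\<^sub>0 * exp (R * G\<^sub>1) \<le> S"
    using abs_le_L2_set[of 0 "{..k}" "\<lambda>i. p (z i)"] G p0 by (simp add: S_def z_def)
  have Sk: "\<bar>p (z k)\<bar> \<le> S"
    unfolding S_def by (rule abs_le_L2_set) auto
  have Spos: "0 < S"
    using S0 G by (intro less_le_trans[OF _ S0]) simp
  have step: "z (Suc k) \<le> max (- R) (z k - \<eta> * (p (z k) / S))"
    by (simp add: z_def p_def S_def clip_def)
  \<comment> \<open>The projection can raise a point only up to \<open>- R\<close>, which is below
    the claimed bound.\<close>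
  have "- R \<le> 7 / 8 * R + real (Suc k) * \<delta>"
    using R mult_pos_pos[of "real (Suc k)" \<delta>] \<delta> by linarith
  moreover have "z k - \<eta> * (p (z k) / S) \<le> 7 / 8 * R + real (Suc k) * \<delta>"
  proof (cases "z k \<le> 3 / 8 * R")
    \<comment> \<open>The current slope is itself part of the norm, so no step exceeds
      \<open>\<eta> \<le> R / 2\<close>, and 3/8 + 1/2 = 7/8.\<close>
    case True
    have "- (p (z k) / S) \<le> 1"
      using Sk Spos by (simp add: divide_simps)
    then have "\<eta> * - (p (z k) / S) \<le> \<eta> * 1"
      using \<eta> by (intro mult_left_mono) auto
    moreover have "0 \<le> real (Suc k) * \<delta>"
      using \<delta> by simp
    ultimately show ?thesis
      using True \<eta> by simp
  next
    case False
    have "- p (z k) \<le> G\<^sub>0 * exp (5 / 8 * (R * G\<^sub>1))"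
    proof (cases "z k < R")
      case True
      have "G\<^sub>1 * (R - z k) \<le> G\<^sub>1 * (5 / 8 * R)"
        using False G by (intro mult_left_mono) auto
      then have "min (G\<^sub>1 * (R - z k)) (R * G\<^sub>1) \<le> 5 / 8 * (R * G\<^sub>1)"
        by (simp add: mult.commute)
      then show ?thesis
        using True G by (simp add: p_def hard_slope_left)
    next
      case False
      have "- p (z k) \<le> 0"
        using False G by (simp add: p_def hard_slope_right)
      also have "0 \<le> G\<^sub>0 * exp (5 / 8 * (R * G\<^sub>1))"
        using G by simp
      finally show ?thesis .
    qed
    then have "- (p (z k) / S) \<le> G\<^sub>0 * exp (5 / 8 * (R * G\<^sub>1)) / S"
      using Spos by (simp add: divide_simps)
    also have "\<dots> \<le> G\<^sub>0 * exp (5 / 8 * (R * G\<^sub>1)) / (G\<^sub>0 * exp (R * G\<^sub>1))"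
      using S0 G Spos by (intro divide_left_mono) auto
    also have "\<dots> = exp (- (3 / 8 * (R * G\<^sub>1)))"
      using G by (simp flip: exp_diff)
    finally have "\<eta> * - (p (z k) / S) \<le> \<eta> * exp (- (3 / 8 * (R * G\<^sub>1)))"
      using \<eta> by (intro mult_left_mono) auto
    also have "\<dots> \<le> R / 2 * exp (- (3 / 8 * (R * G\<^sub>1)))"
      using \<eta> by (intro mult_right_mono) auto
    finally have "\<eta> * - (p (z k) / S) \<le> R / 2 * exp (- (3 / 8 * (R * G\<^sub>1)))" .
    then have "\<eta> * - (p (z k) / S) \<le> \<delta>"
      by (simp only: \<delta>_def)
    then show ?thesis
      using Suc unfolding \<delta>_def[symmetric] by (simp add: distrib_right)
  qed
  ultimately show ?case
    using step by (simp add: \<delta>_def)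
qed

text \<open>The first step has length exactly \<open>\<eta>\<close> before projection, hence reaches
  at least \<open>R / 2\<close>; \<open>k\<close> counts the later steps. Each of these moves left
  by at most \<open>\<eta>\<close> times the ratio of the largest positive slope
  \<open>G\<^sub>0 * exp (R * G\<^sub>1 / 32)\<close> to the initial one
  \<open>G\<^sub>0 * exp (R * G\<^sub>1 / 8)\<close>, and 1/8 - 1/32 = 3/32. Negative slopes only
  push right.\<close>

lemma overshoot_regime:
  assumes G: "0 < G\<^sub>0" "0 < G\<^sub>1" and R: "0 < R" and \<eta>: "R / 2 \<le> \<eta>"
  defines "z \<equiv> line_iterate R \<eta> (hard_slope G\<^sub>0 G\<^sub>1 (R / 8) (R * G\<^sub>1 / 32) (R * G\<^sub>1))"
  shows "R / 2 - real k * (\<eta> * exp (- (3 / 32 * (R * G\<^sub>1)))) \<le> z (Suc k)"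
proof -
  define p where "p = hard_slope G\<^sub>0 G\<^sub>1 (R / 8) (R * G\<^sub>1 / 32) (R * G\<^sub>1)"
  define S where "S k = L2_set (\<lambda>i. p (z i)) {..k}" for k
  define \<delta> where "\<delta> = \<eta> * exp (- (3 / 32 * (R * G\<^sub>1)))"
  have \<eta>0: "0 < \<eta>"
    using \<eta> R by linarith
  then have \<delta>: "0 < \<delta>"
    by (simp add: \<delta>_def)
  have p0: "p 0 = - (G\<^sub>0 * exp (R * G\<^sub>1 / 8))"
    using G R by (simp add: p_def hard_slope_left mult.commute min_def)
  have S0: "G\<^sub>0 * exp (R * G\<^sub>1 / 8) \<le> S k" for k
    using abs_le_L2_set[of 0 "{..k}" "\<lambda>i. p (z i)"] G p0 by (simp add: S_def z_def)
  have Spos: "0 < S k" for k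
    using G by (intro less_le_trans[OF _ S0]) simp
  have step: "min R (z k - \<eta> * (p (z k) / S k)) \<le> z (Suc k)" for k
    by (simp add: z_def p_def S_def clip_def)
  have "R / 2 - real k * \<delta> \<le> z (Suc k)"
  proof (induction k)
    case 0
    have "S 0 = - p 0"
      using p0 G by (simp add: S_def z_def)
    then have "p (z 0) / S 0 = - 1"
      using p0 G by (simp add: z_def)
    then show ?case
      using step[of 0] \<eta> R by (simp add: z_def)
  next
    case (Suc k)
    have "p (z (Suc k)) / S (Suc k) \<le> G\<^sub>0 * exp (R * G\<^sub>1 / 32) / S (Suc k)"
      using hard_slope_le[OF G(1)] Spos[of "Suc k"] by (simp add: p_def divide_right_mono)
    also have "\<dots> \<le> G\<^sub>0 * exp (R * G\<^sub>1 / 32) / (G\<^sub>0 * exp (R * G\<^sub>1 / 8))"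
      using S0[of "Suc k"] G Spos[of "Suc k"] by (intro divide_left_mono) auto
    also have "\<dots> = exp (- (3 / 32 * (R * G\<^sub>1)))"
      using G by (simp flip: exp_diff)
    finally have "\<eta> * (p (z (Suc k)) / S (Suc k)) \<le> \<delta>"
      unfolding \<delta>_def using \<eta>0 by (intro mult_left_mono) auto
    moreover have "0 \<le> real (Suc k) * \<delta>"
      using \<delta> by simp
    ultimately show ?case
      using step[of "Suc k"] Suc R by (simp add: algebra_simps min_le_iff_disj) linarith
  qed
  then show ?thesis
    by (simp add: \<delta>_def)
qed

text \<open>All slopes have the same modulus, so the step at time \<open>k\<close> has length \<open>\<eta> / sqrt (k + 1)\<close> and
  is cut off by the projection as long as this exceeds \<open>2R\<close>.\<close>

lemma bouncing_regime:
  assumes G: "0 < G\<^sub>0" "0 < G\<^sub>1" and R: "0 < R" and \<eta>: "0 < \<eta>"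
  defines "z \<equiv> line_iterate R \<eta> (hard_slope G\<^sub>0 G\<^sub>1 (3 / 4 * R) (R * G\<^sub>1 / 32) (R * G\<^sub>1 / 32))"
  assumes K: "real K \<le> (\<eta> / (2 * R))\<^sup>2"
  shows "0 < k \<Longrightarrow> k \<le> K \<Longrightarrow> z k = (if even k then - R else R)"
proof (induction k rule: less_induct)
  case (less k)
  define p where "p = hard_slope G\<^sub>0 G\<^sub>1 (3 / 4 * R) (R * G\<^sub>1 / 32) (R * G\<^sub>1 / 32)"
  define s where "s = G\<^sub>0 * exp (R * G\<^sub>1 / 32)"
  have s: "0 < s"
    using G by (simp add: s_def)
  obtain n where n: "k = Suc n"
    using less.prems by (cases k) auto
  have zi: "z i = (if i = 0 then 0 else if even i then - R else R)" if "i \<le> n" for i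
    using less that n by (auto simp: z_def)
  \<comment> \<open>The points 0 and \<open>- R\<close> lie left of \<open>3 / 4 * R\<close> and
    \<open>R\<close> lies right of it, all at distance at least \<open>R / 4\<close>, so both caps
    \<open>R * G\<^sub>1 / 32\<close> are active. The start 0 fits the pattern of even indices in
    sign and modulus.\<close>
  have pz: "p (z i) = (if even i then - s else s)" if "i \<le> n" for i
    using that G R
    by (auto simp: zi p_def s_def hard_slope_left hard_slope_right min_def mult.commute)
  have S: "L2_set (\<lambda>i. p (z i)) {..n} = sqrt (real k) * s"
    using pz s by (subst L2_set_abs_const[of _ _ s]) (auto simp: n)
  have "sqrt (real k) \<le> \<eta> / (2 * R)"
    using K less.prems \<eta> R by (intro real_le_lsqrt) auto
  then have "2 * R * sqrt (real k) \<le> \<eta>"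
    using \<eta> R by (simp add: field_simps)
  then have len: "2 * R \<le> \<eta> / sqrt (real k)"
    using n by (simp add: field_simps)
  have "z k = clip R (z n - \<eta> * (p (z n) / (sqrt (real k) * s)))"
    using S by (simp add: n z_def p_def)
  also have "p (z n) / (sqrt (real k) * s) = (if even n then - 1 else 1) / sqrt (real k)"
    using pz[of n] s by simp
  finally have zk: "z k = clip R (z n + (if even n then 1 else - 1) * (\<eta> / sqrt (real k)))"
    by simp
  show ?case
  proof (cases "even n")
    case True
    then have "- R \<le> z n"
      using zi[of n] R by simp
    then show ?thesis
      using True zk len R by (simp add: n clip_def)
  next
    case False
    then have "z n = R"
      using zi[of n] by (cases "n = 0") auto
    then show ?thesis
      using False zk len R by (simp add: n clip_def)
  qed
qed

lemma sum_alternating: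
  fixes z :: "nat \<Rightarrow> real"
  assumes "\<And>k. 0 < k \<Longrightarrow> k \<le> K \<Longrightarrow> z k = (if even k then - R else R)" "z 0 = 0"
  shows "(\<Sum>k\<le>K. z k) = (if even K then 0 else R)"
  using assms by (induction K) auto

section \<open>Choice of the instance and the lower bound\<close>

lemma exists_far_iterates:
  assumes G: "0 < G\<^sub>0" "0 < G\<^sub>1" and R: "0 < R" "32 \<le> R * G\<^sub>1" and \<eta>: "0 < \<eta>"
  obtains m A B where "\<bar>m\<bar> \<le> R" "R * G\<^sub>1 / 32 \<le> A" "R * G\<^sub>1 / 32 \<le> B"
    "\<forall>K. real K < exp (R * G\<^sub>1 / 16) / 8 \<longrightarrow>
      R / 16 \<le> \<bar>line_iterate R \<eta> (hard_slope G\<^sub>0 G\<^sub>1 m A B) K - m\<bar> \<and>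
      R / 16 \<le> \<bar>line_average R \<eta> (hard_slope G\<^sub>0 G\<^sub>1 m A B) K - m\<bar>"
proof -
  define \<rho> where "\<rho> = R * G\<^sub>1"
  have \<rho>: "32 \<le> \<rho>"
    using R by (simp add: \<rho>_def)
  \<comment> \<open>The upper threshold balances two demands for \<open>K\<close> below
    \<open>exp (\<rho> / 16) / 8\<close>. The slow return covers at most \<open>R / 8\<close>,
    because 1/16 + 1/32 = 3/32; and bouncing lasts long enough, because
    \<open>(\<eta> / (2 * R))\<^sup>2\<close> is at least
    \<open>exp (\<rho> / 16) / 4\<close>.\<close>
  consider "\<eta> \<le> R / 2" | "R / 2 \<le> \<eta>" "\<eta> \<le> R * exp (\<rho> / 32)" | "R * exp (\<rho> / 32) \<le> \<eta>"
    by linarith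
  then show ?thesis
  proof cases
    case 1
    let ?z = "line_iterate R \<eta> (hard_slope G\<^sub>0 G\<^sub>1 R \<rho> \<rho>)"
    show ?thesis
    proof (rule that[of R \<rho> \<rho>]; (intro allI impI)?)
      fix K :: nat
      assume K: "real K < exp (R * G\<^sub>1 / 16) / 8"
      \<comment> \<open>The drift of at most \<open>R / 16\<close> on top of
        \<open>7 / 8 * R\<close> still leaves \<open>R / 16\<close> to the minimizer
        \<open>R\<close>.\<close>
      have "?z k \<le> 15 / 16 * R" if "k \<le> K" for k
      proof -
        have "exp (\<rho> / 16) \<le> exp (3 / 8 * \<rho>)"
          using \<rho> by simp
        then have "real k \<le> exp (3 / 8 * \<rho>) / 8"
          using that K unfolding \<rho>_def[symmetric] by linarith
        then have "real k * (R / 2 * exp (- (3 / 8 * \<rho>))) \<le> exp (3 / 8 * \<rho>) / 8 * (R / 2 * exp (- (3 / 8 * \<rho>)))"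
          using R by (intro mult_right_mono) auto
        also have "\<dots> = R / 16"
          by (simp add: exp_minus field_simps)
        finally show ?thesis
          using short_step_regime[OF G R(1) \<eta> 1, of k] unfolding \<rho>_def by linarith
      qed
      then show "R / 16 \<le> \<bar>?z K - R\<bar> \<and>
          R / 16 \<le> \<bar>line_average R \<eta> (hard_slope G\<^sub>0 G\<^sub>1 R \<rho> \<rho>) K - R\<bar>"
        using line_average_le[of K R \<eta> "hard_slope G\<^sub>0 G\<^sub>1 R \<rho> \<rho>" "15 / 16 * R"] R(1)
        by fastforce
    qed (use G R \<rho> in \<open>auto simp: \<rho>_def\<close>)
  next
    case 2
    let ?h = "hard_slope G\<^sub>0 G\<^sub>1 (R / 8) (\<rho> / 32) \<rho>"
    show ?thesis
    proof (rule that[of "R / 8" "\<rho> / 32" \<rho>]; (intro allI impI)?)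
      fix K :: nat
      assume K: "real K < exp (R * G\<^sub>1 / 16) / 8"
      have far: "3 / 8 * R \<le> line_iterate R \<eta> ?h (Suc k)" if "k \<le> K" for k
      proof -
        have "real k * (\<eta> * exp (- (3 / 32 * \<rho>)))
            \<le> exp (\<rho> / 16) / 8 * (R * exp (\<rho> / 32) * exp (- (3 / 32 * \<rho>)))"
          using that K 2 \<eta> unfolding \<rho>_def[symmetric] by (intro mult_mono) auto
        also have "\<dots> = R / 8 * exp (\<rho> / 16 + \<rho> / 32 + - (3 / 32 * \<rho>))"
          unfolding exp_add by simp
        also have "\<dots> = R / 8"
          by simp
        finally show ?thesis
          using overshoot_regime[OF G R(1) 2(1), of k] by (simp add: \<rho>_def)
      qed
      show "R / 16 \<le> \<bar>line_iterate R \<eta> ?h K - R / 8\<bar> \<and> R / 16 \<le> \<bar>line_average R \<eta> ?h K - R / 8\<bar>"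
      proof (cases K)
        case 0
        then show ?thesis
          using R by (simp add: line_average_def)
      next
        case (Suc n)
        have "(\<Sum>k\<le>K. line_iterate R \<eta> ?h k) = (\<Sum>k\<le>n. line_iterate R \<eta> ?h (Suc k))"
          unfolding Suc sum.atMost_Suc_shift by simp
        also have "\<dots> \<ge> (\<Sum>k\<le>n. 3 / 8 * R)"
          using far Suc by (intro sum_mono) auto
        finally have "real (n + 1) * (3 / 8 * R) \<le> (\<Sum>k\<le>K. line_iterate R \<eta> ?h k)"
          by simp
        \<comment> \<open>Only the start 0 lies outside the bound \<open>3 / 8 * R\<close>; its
          weight in the average is at most one half. The resulting \<open>3 / 16 * R\<close> exceeds
          the minimizer \<open>R / 8\<close> by \<open>R / 16\<close>.\<close>
        moreover have "3 / 16 * R * real (n + 2) \<le> real (n + 1) * (3 / 8 * R)"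
          using R by (simp add: algebra_simps)
        ultimately have "3 / 16 * R * real (n + 2) \<le> (\<Sum>k\<le>K. line_iterate R \<eta> ?h k)"
          by linarith
        then have "3 / 16 * R \<le> line_average R \<eta> ?h K"
          by (simp add: line_average_def pos_le_divide_eq Suc del: line_iterate.simps sum.atMost_Suc)
        then show ?thesis
          using far[of n] Suc R by simp
      qed
    qed (use G R \<rho> in \<open>auto simp: \<rho>_def\<close>)
  next
    case 3
    let ?h = "hard_slope G\<^sub>0 G\<^sub>1 (3 / 4 * R) (\<rho> / 32) (\<rho> / 32)"
    show ?thesis
    proof (rule that[of "3 / 4 * R" "\<rho> / 32" "\<rho> / 32"]; (intro allI impI)?)
      fix K :: nat
      assume K: "real K < exp (R * G\<^sub>1 / 16) / 8"
      have "(R * exp (\<rho> / 32) / (2 * R))\<^sup>2 \<le> (\<eta> / (2 * R))\<^sup>2"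
        using 3 R by (intro power_mono divide_right_mono) auto
      moreover have "(R * exp (\<rho> / 32) / (2 * R))\<^sup>2 = exp (\<rho> / 16) / 4"
        using R by (simp add: power_divide flip: exp_double)
      moreover have "0 < exp (\<rho> / 16)"
        by simp
      ultimately have "real K \<le> (\<eta> / (2 * R))\<^sup>2"
        using K unfolding \<rho>_def[symmetric] by linarith
      then have z: "line_iterate R \<eta> ?h k = (if even k then - R else R)" if "0 < k" "k \<le> K" for k
        using bouncing_regime[OF G R(1) \<eta>, of K k] that by (simp add: \<rho>_def)
      have avg: "line_average R \<eta> ?h K = (if even K then 0 else R) / real (K + 1)"
        unfolding line_average_def using sum_alternating[of K "line_iterate R \<eta> ?h", OF z] by simp
      \<comment> \<open>The bounces cancel in pairs. An unpaired \<open>R\<close> remains only for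
        odd \<open>K\<close>, where it is divided by \<open>K + 1 \<ge> 2\<close>.\<close>
      have "line_average R \<eta> ?h K \<le> R / 2"
      proof (cases "even K")
        case False
        then have "2 \<le> real (K + 1)"
          by (cases K) auto
        then have "R / real (K + 1) \<le> R / 2"
          using R by (intro divide_left_mono) auto
        then show ?thesis
          using False avg by simp
      qed (use avg R in simp)
      moreover have "line_iterate R \<eta> ?h K \<in> {0, - R, R}"
        using z[of K] by (cases K) (auto split: if_splits)
      ultimately show "R / 16 \<le> \<bar>line_iterate R \<eta> ?h K - 3 / 4 * R\<bar> \<and>
          R / 16 \<le> \<bar>line_average R \<eta> ?h K - 3 / 4 * R\<bar>"
        using R by auto
    qed (use G R \<rho> in \<open>auto simp: \<rho>_def\<close>)
  qed
qed

lemma exists_hard_instance: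
  assumes d: "1 \<le> d" and G: "0 < G\<^sub>0" "0 < G\<^sub>1" and R: "0 < R" "32 \<le> R * G\<^sub>1" and \<eta>: "0 < \<eta>"
    and \<epsilon>: "0 < \<epsilon>" "\<epsilon> \<le> G\<^sub>0 / G\<^sub>1 * exp (1 / 64 * R * G\<^sub>1)"
  shows "\<exists>(f :: (nat \<Rightarrow> real) \<Rightarrow> real) (xstar :: nat \<Rightarrow> real) (gradf :: (nat \<Rightarrow> real) \<Rightarrow> (nat \<Rightarrow> real))
        (D :: real measure) (g :: real \<Rightarrow> (nat \<Rightarrow> real) \<Rightarrow> (nat \<Rightarrow> real)).
       convex_on (Rd d) f \<and>
       is_arg_min f (\<lambda>x. x \<in> Rd d) xstar \<and> norm_Rd d xstar \<le> R \<and>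
       prob_space D \<and> stochastic_gen_Lipschitz G\<^sub>0 G\<^sub>1 d f (f xstar) gradf D g \<and>
       (\<forall>K::nat. expected_gap d R \<eta> f (f xstar) D g K \<le> ennreal \<epsilon> \<longrightarrow>
          real K \<ge> 1 / 8 * exp (1 / 16 * R * G\<^sub>1))"
proof -
  obtain m A B where m: "\<bar>m\<bar> \<le> R" and AB: "R * G\<^sub>1 / 32 \<le> A" "R * G\<^sub>1 / 32 \<le> B"
    and far: "\<forall>K. real K < exp (R * G\<^sub>1 / 16) / 8 \<longrightarrow>
      R / 16 \<le> \<bar>line_iterate R \<eta> (hard_slope G\<^sub>0 G\<^sub>1 m A B) K - m\<bar> \<and>
      R / 16 \<le> \<bar>line_average R \<eta> (hard_slope G\<^sub>0 G\<^sub>1 m A B) K - m\<bar>"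
    by (rule exists_far_iterates[OF G R \<eta>])
  define h where "h t = G\<^sub>0 / G\<^sub>1 * valley A B (G\<^sub>1 * (t - m))" for t
  define h' where "h' = hard_slope G\<^sub>0 G\<^sub>1 m A B"
  \<comment> \<open>Since the oracle ignores the seed, a point mass serves as its
    distribution.\<close>
  define D :: "real measure" where "D = return borel 0"
  have D: "prob_space D"
    unfolding D_def by (intro prob_space_return) auto
  have AB0: "0 \<le> A" "0 \<le> B"
    using AB R by linarith+
  have hm: "h m = 0"
    using AB0 by (simp add: h_def valley_def)
  have h0: "0 \<le> h t" for t
    using G valley_nonneg[OF AB0] by (simp add: h_def)
  have sub: "h x + h' x * (y - x) \<le> h y" for x y
  proof -
    have "h x + h' x * (y - x) = G\<^sub>0 / G\<^sub>1 * (valley A B (G\<^sub>1 * (x - m)) +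
        valley_slope A B (G\<^sub>1 * (x - m)) * (G\<^sub>1 * (y - m) - G\<^sub>1 * (x - m)))"
      using G by (simp add: h_def h'_def hard_slope_def field_simps)
    also have "\<dots> \<le> h y"
      unfolding h_def using G by (intro mult_left_mono valley_subgradient AB0) auto
    finally show ?thesis .
  qed
  have growth: "\<bar>h' t\<bar> \<le> G\<^sub>0 + G\<^sub>1 * (h t - h m)" for t
    using mult_left_mono[OF abs_valley_slope_le[of A B "G\<^sub>1 * (t - m)"], of G\<^sub>0] G
    unfolding hm by (simp add: h_def h'_def hard_slope_def abs_mult distrib_left)
  have meas: "h' \<in> borel_measurable borel"
    unfolding h'_def hard_slope_def using valley_slope_measurable[of A B] by measurable
  \<comment> \<open>Distance \<open>R / 16\<close> from \<open>m\<close> becomes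
    \<open>R * G\<^sub>1 / 16\<close> in the variable of \<open>valley\<close>. The assumed upper
    bound on \<open>\<epsilon>\<close> enters here.\<close>
  have gap: "\<epsilon> < h t" if "R / 16 \<le> \<bar>t - m\<bar>" for t
  proof -
    have "R * G\<^sub>1 / 16 \<le> \<bar>G\<^sub>1 * (t - m)\<bar>"
      using mult_left_mono[OF that, of G\<^sub>1] G by (simp add: abs_mult mult.commute)
    then have "G\<^sub>0 / G\<^sub>1 * exp (R * G\<^sub>1 / 64) < h t"
      unfolding h_def using G valley_gt[OF R(2) AB] by (intro mult_strict_left_mono) auto
    then show ?thesis
      using \<epsilon> by simp
  qed
  have "1 / 8 * exp (1 / 16 * R * G\<^sub>1) \<le> real K"
    if "expected_gap d R \<eta> (\<lambda>x. h (x 0)) (h m) D (\<lambda>_ x. e0 (h' (x 0))) K \<le> ennreal \<epsilon>" for K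
  proof (rule ccontr)
    assume "\<not> ?thesis"
    \<comment> \<open>For smaller \<open>K\<close> both the last iterate and the average are far
      from \<open>m\<close>, so the gap, a deterministic number, exceeds
      \<open>\<epsilon>\<close>.\<close>
    then have "\<epsilon> < min (h (line_iterate R \<eta> h' K)) (h (line_average R \<eta> h' K)) - h m"
      using far gap by (simp add: h'_def hm)
    moreover have "min (h (line_iterate R \<eta> h' K)) (h (line_average R \<eta> h' K)) - h m \<le> \<epsilon>"
      using that R \<epsilon> by (simp add: expected_gap_e0[OF d _ D])
    ultimately show False
      by simp
  qed
  moreover have "is_arg_min (\<lambda>x. h (x 0)) (\<lambda>x. x \<in> Rd d) (e0 m)"
    using h0 hm by (simp add: is_arg_min_linorder e0_in_Rd[OF d])
  moreover have "stochastic_gen_Lipschitz G\<^sub>0 G\<^sub>1 d (\<lambda>x. h (x 0)) (h m) (\<lambda>x. e0 (h' (x 0))) D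
      (\<lambda>_ x. e0 (h' (x 0)))"
    using G h0 hm by (intro stochastic_gen_Lipschitz_e0 d D sub growth meas) auto
  moreover have "norm_Rd d (e0 m) \<le> R"
    using m by (simp add: norm_Rd_e0[OF d])
  moreover note convex_on_Rd_of_subgradient[of h h' d, OF sub] D
  ultimately show ?thesis
    by (intro exI[of _ "\<lambda>x. h (x 0)"] exI[of _ "e0 m"] exI[of _ "\<lambda>x. e0 (h' (x 0))"]
        exI[of _ D] exI[of _ "\<lambda>_ x. e0 (h' (x 0))"] conjI allI impI)
      (simp_all only: e0_nth)
qed

theorem theorem9:
  shows "\<exists>c\<^sub>1>0. \<exists>c\<^sub>2>0. \<forall>(d::nat) (G\<^sub>0::real) (G\<^sub>1::real) (R::real) (\<epsilon>::real) (\<eta>::real).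
    d \<ge> 1 \<and> G\<^sub>0 > 0 \<and> G\<^sub>1 > 0 \<and> R > 0 \<and> \<epsilon> > 0 \<and> \<eta> > 0 \<and>
    \<epsilon> \<le> G\<^sub>0 / G\<^sub>1 * exp (1 / 64 * R * G\<^sub>1) \<and> R * G\<^sub>1 \<ge> 32 \<longrightarrow>
    (\<exists>(f :: (nat \<Rightarrow> real) \<Rightarrow> real) (xstar :: nat \<Rightarrow> real) (gradf :: (nat \<Rightarrow> real) \<Rightarrow> (nat \<Rightarrow> real))
        (D :: real measure) (g :: real \<Rightarrow> (nat \<Rightarrow> real) \<Rightarrow> (nat \<Rightarrow> real)).
       convex_on (Rd d) f \<and>
       is_arg_min f (\<lambda>x. x \<in> Rd d) xstar \<and> norm_Rd d xstar \<le> R \<and>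
       prob_space D \<and> stochastic_gen_Lipschitz G\<^sub>0 G\<^sub>1 d f (f xstar) gradf D g \<and>
       (\<forall>K::nat. expected_gap d R \<eta> f (f xstar) D g K \<le> ennreal \<epsilon> \<longrightarrow>
          real K \<ge> c\<^sub>1 * exp (c\<^sub>2 * R * G\<^sub>1)))"
  by (rule exI[of _ "1 / 8"], rule conjI, simp, rule exI[of _ "1 / 16"], rule conjI, simp,
      (rule allI)+, rule impI, (erule conjE)+, rule exists_hard_instance; assumption)

end
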